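(* Let $p$ be a prime, $G=\mathrm{Aff}(1,\mathbb{F}_p)$, $U\leq G$ the translation subgroup, and let $K\geq1$. If $A$ is a finite subset of $G$ such that $|A^3|\leq K|A|$, then either at least $|A|/3$ elements of $A$ are contained in a maximal torus, or \[ K^{10}|A|\gg|A/U|^{1/2}|A|, \] or \[ K^{10}|A|\gg|A/U|\,p. \]
   Context: $\mathrm{Aff}(1,\mathbb{F}_p)$ is the group of maps $x\mapsto ax+b$ ($a\neq0$) under composition. $U=\{x\mapsto x+b: b\in\mathbb{F}_p\}$. A maximal torus is a subgroup conjugate to the dilation subgroup $\{x\mapsto ax: a\in\mathbb{F}_p^*\}$. $A^3=\{a_1a_2a_3: a_i\in A\}$. $A/U$ is the set of left cosets $aU$ with $a\in A$. $f\gg g$ means $f\geq cg$ for an absolute constant $c>0$. *)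

theory Defs
  imports Complex_Main "HOL-Algebra.Bij" "HOL-Algebra.Coset" "HOL-Number_Theory.Residues"
begin

definition affine_map :: "('a, 'm) ring_scheme \<Rightarrow> 'a \<Rightarrow> 'a \<Rightarrow> 'a \<Rightarrow> 'a" where
  "affine_map R a b = (\<lambda>x\<in>carrier R. a \<otimes>\<^bsub>R\<^esub> x \<oplus>\<^bsub>R\<^esub> b)"

text \<open>The group operation is the one of \<^const>\<open>BijGroup\<close>: the product \<open>g \<otimes> f\<close> is the
  composite \<open>x \<mapsto> g (f x)\<close>. The maps are extensional, so equality in the group is equality as maps
  on \<open>carrier R\<close>.\<close>

definition Aff :: "('a, 'm) ring_scheme \<Rightarrow> ('a \<Rightarrow> 'a) monoid" where
  "Aff R = BijGroup (carrier R)
     \<lparr>carrier := {affine_map R a b |a b. a \<in> carrier R - {\<zero>\<^bsub>R\<^esub>} \<and> b \<in> carrier R}\<rparr>"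

definition translation_subgroup :: "('a, 'm) ring_scheme \<Rightarrow> ('a \<Rightarrow> 'a) set" where
  "translation_subgroup R = {affine_map R \<one>\<^bsub>R\<^esub> b |b. b \<in> carrier R}"

definition dilation_subgroup :: "('a, 'm) ring_scheme \<Rightarrow> ('a \<Rightarrow> 'a) set" where
  "dilation_subgroup R = {affine_map R a \<zero>\<^bsub>R\<^esub> |a. a \<in> carrier R - {\<zero>\<^bsub>R\<^esub>}}"

definition maximal_torus :: "('a, 'm) ring_scheme \<Rightarrow> ('a \<Rightarrow> 'a) set \<Rightarrow> bool" where
  "maximal_torus R T \<longleftrightarrow> subgroup T (Aff R) \<and>
     (\<exists>g\<in>carrier (Aff R). T = (\<lambda>h. g \<otimes>\<^bsub>Aff R\<^esub> h \<otimes>\<^bsub>Aff R\<^esub> inv\<^bsub>Aff R\<^esub> g) ` dilation_subgroup R)"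

text \<open>The left cosets \<open>a U\<close> with \<open>a \<in> A\<close>; \<open>A\<close> need not be a union of cosets.\<close>

definition left_cosets_of :: "('g, 'm) monoid_scheme \<Rightarrow> 'g set \<Rightarrow> 'g set \<Rightarrow> 'g set set" where
  "left_cosets_of G A U = (\<lambda>a. a <#\<^bsub>G\<^esub> U) ` A"

context field
begin

lemma affine_map_Bij:
  assumes "a \<in> carrier R - {\<zero>}" "b \<in> carrier R"
  shows "affine_map R a b \<in> Bij (carrier R)"
proof -
  have a: "a \<in> carrier R" "inv a \<in> carrier R" "inv a \<otimes> a = \<one>" "a \<otimes> inv a = \<one>"
    using assms field_Units by auto
  have "bij_betw (affine_map R a b) (carrier R) (carrier R)"
  proof (rule bij_betw_byWitness[where f' = "\<lambda>y. inv a \<otimes> (y \<ominus> b)"])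
    show "\<forall>x\<in>carrier R. inv a \<otimes> (affine_map R a b x \<ominus> b) = x"
    proof
      fix x assume x: "x \<in> carrier R"
      then have "a \<otimes> x \<oplus> b \<ominus> b = a \<otimes> x"
        using a assms by (simp add: a_minus_def a_assoc r_neg)
      then show "inv a \<otimes> (affine_map R a b x \<ominus> b) = x"
        using a x by (simp add: affine_map_def flip: m_assoc)
    qed
    show "\<forall>y\<in>carrier R. affine_map R a b (inv a \<otimes> (y \<ominus> b)) = y"
      using a assms by (auto simp: affine_map_def a_minus_def a_assoc l_neg simp flip: m_assoc)
  qed (use a assms in \<open>auto simp: affine_map_def\<close>)
  then show ?thesis
    by (simp add: Bij_def affine_map_def)
qed

lemma affine_map_mult:
  assumes "a \<in> carrier R - {\<zero>}" "b \<in> carrier R" "c \<in> carrier R - {\<zero>}" "d \<in> carrier R"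
  shows "affine_map R a b \<otimes>\<^bsub>Aff R\<^esub> affine_map R c d = affine_map R (a \<otimes> c) (a \<otimes> d \<oplus> b)"
proof -
  have "affine_map R a b \<otimes>\<^bsub>Aff R\<^esub> affine_map R c d
      = compose (carrier R) (affine_map R a b) (affine_map R c d)"
    using assms by (simp add: Aff_def BijGroup_def affine_map_Bij)
  also have "\<dots> = affine_map R (a \<otimes> c) (a \<otimes> d \<oplus> b)"
    using assms by (auto simp: compose_def affine_map_def r_distr m_assoc a_assoc)
  finally show ?thesis .
qed

lemma affine_map_one: "affine_map R \<one> \<zero> = \<one>\<^bsub>Aff R\<^esub>"
  by (auto simp: Aff_def BijGroup_def affine_map_def)

lemma group_Aff: "group (Aff R)"
proof (rule groupI)
  have car: "\<And>f. f \<in> carrier (Aff R) \<longleftrightarrow>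
      (\<exists>a b. f = affine_map R a b \<and> a \<in> carrier R - {\<zero>} \<and> b \<in> carrier R)"
    by (auto simp: Aff_def)
  show "\<one>\<^bsub>Aff R\<^esub> \<in> carrier (Aff R)"
    unfolding car affine_map_one[symmetric] by force
  show closed: "x \<otimes>\<^bsub>Aff R\<^esub> y \<in> carrier (Aff R)"
    if x: "x \<in> carrier (Aff R)" and y: "y \<in> carrier (Aff R)" for x y
  proof -
    obtain a b c d where *: "x = affine_map R a b" "y = affine_map R c d"
      "a \<in> carrier R - {\<zero>}" "b \<in> carrier R" "c \<in> carrier R - {\<zero>}" "d \<in> carrier R"
      using x y unfolding car by (elim exE conjE)
    then have "a \<otimes> c \<in> carrier R - {\<zero>}" "a \<otimes> d \<oplus> b \<in> carrier R"
      by (simp_all add: integral_iff)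
    then show ?thesis
      unfolding car *(1,2) affine_map_mult[OF *(3-6)] by blast
  qed
  have Bij: "x \<in> Bij (carrier R)" if "x \<in> carrier (Aff R)" for x
    using that affine_map_Bij unfolding car by blast
  interpret B: group "BijGroup (carrier R)" by (rule group_BijGroup)
  have mult: "monoid.mult (Aff R) = monoid.mult (BijGroup (carrier R))" "one (Aff R) = one (BijGroup (carrier R))"
    by (simp_all add: Aff_def)
  have BijG: "x \<in> carrier (BijGroup (carrier R))" if "x \<in> carrier (Aff R)" for x
    using Bij[OF that] by (simp add: BijGroup_def)
  show "x \<otimes>\<^bsub>Aff R\<^esub> y \<otimes>\<^bsub>Aff R\<^esub> z = x \<otimes>\<^bsub>Aff R\<^esub> (y \<otimes>\<^bsub>Aff R\<^esub> z)"
    if "x \<in> carrier (Aff R)" "y \<in> carrier (Aff R)" "z \<in> carrier (Aff R)" for x y z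
    unfolding mult by (intro B.m_assoc BijG that)
  show "\<one>\<^bsub>Aff R\<^esub> \<otimes>\<^bsub>Aff R\<^esub> x = x" if "x \<in> carrier (Aff R)" for x
    unfolding mult by (intro B.l_one BijG that)
  show "\<exists>y\<in>carrier (Aff R). y \<otimes>\<^bsub>Aff R\<^esub> x = \<one>\<^bsub>Aff R\<^esub>" if x: "x \<in> carrier (Aff R)" for x
  proof -
    obtain a b where *: "x = affine_map R a b" "a \<in> carrier R - {\<zero>}" "b \<in> carrier R"
      using x unfolding car by blast
    have a: "inv a \<in> carrier R - {\<zero>}" "inv a \<otimes> a = \<one>"
      using * field_Units by auto
    define y where "y = affine_map R (inv a) (\<ominus> (inv a \<otimes> b))"
    have "y \<in> carrier (Aff R)"
      unfolding car y_def using a * by blast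
    moreover have "y \<otimes>\<^bsub>Aff R\<^esub> x = \<one>\<^bsub>Aff R\<^esub>"
    proof -
      have "y \<otimes>\<^bsub>Aff R\<^esub> x = affine_map R (inv a \<otimes> a) (inv a \<otimes> b \<oplus> \<ominus> (inv a \<otimes> b))"
        unfolding y_def *(1) using a * by (intro affine_map_mult) auto
      also have "\<dots> = affine_map R \<one> \<zero>"
        using a * by (simp add: r_neg)
      finally show ?thesis
        by (simp only: affine_map_one)
    qed
    ultimately show ?thesis by blast
  qed
qed

end

end

theory Submission
  imports Defs "HOL-Analysis.Convex"
begin

text \<open>A pivot argument. Let \<open>Q\<close> be the set of points of the field that are fixed by some \<open>a\<^sup>-\<^sup>1b\<close> with
  \<open>a, b \<in> A\<close> of different slope. Some \<open>x \<in> Q\<close> and \<open>h \<in> A\<close> give an orbit \<open>A(h x)\<close> of size at least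
  \<open>min(|A|, p)/2\<close>: if \<open>h x \<notin> Q\<close> for some such pair, then \<open>a \<mapsto> a(h x)\<close> is injective on \<open>A\<close>; otherwise
  \<open>Q\<close> is stable under \<open>A\<close>, hence (unless \<open>A\<close> fixes a point, i.e. lies in a torus, or has a single
  slope) under a commutator that is a nontrivial translation, so \<open>Q\<close> is the whole field and an average
  over all points applies. Now \<open>w = h a\<^sup>-\<^sup>1b h\<^sup>-\<^sup>1\<close> fixes \<open>h x\<close>, and its conjugates by \<open>A\<close> all lie in one
  coset of \<open>U\<close> and are told apart by their fixed points, which run through \<open>A(h x)\<close>. Multiplying them
  by \<open>A\<close> gives \<open>|A/U| |A(h x)| \<le> |AAwA\<^sup>-\<^sup>1|\<close>, and the Ruzsa triangle inequality bounds the right-hand side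
  by \<open>K\<^sup>8|A|\<close>.\<close>

section \<open>Product sets in a group: Ruzsa calculus and small tripling\<close>

context group
begin

lemma set_multI: "h \<in> H \<Longrightarrow> k \<in> K \<Longrightarrow> h \<otimes> k \<in> H <#> K"
  by (auto simp: set_mult_def)

lemma set_invI: "h \<in> H \<Longrightarrow> inv h \<in> set_inv H"
  by (auto simp: SET_INV_def)

lemma finite_set_mult: "finite H \<Longrightarrow> finite K \<Longrightarrow> finite (H <#> K)"
  by (simp add: set_mult_def)

lemma set_inv_closed: "H \<subseteq> carrier G \<Longrightarrow> set_inv H \<subseteq> carrier G"
  by (auto simp: SET_INV_def)

lemma finite_set_inv: "finite H \<Longrightarrow> finite (set_inv H)"
  by (simp add: SET_INV_def)

lemma card_set_inv:
  assumes "H \<subseteq> carrier G"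
  shows "card (set_inv H) = card H"
proof -
  have "set_inv H = m_inv G ` H"
    by (auto simp: SET_INV_def)
  moreover have "inj_on (m_inv G) H"
    using inv_inj assms by (rule inj_on_subset)
  ultimately show ?thesis
    by (simp add: card_image)
qed

lemma set_inv_set_inv:
  assumes "H \<subseteq> carrier G"
  shows "set_inv (set_inv H) = H"
  using assms by (force simp: SET_INV_def)

lemma set_inv_set_mult:
  assumes "H \<subseteq> carrier G" "K \<subseteq> carrier G"
  shows "set_inv (H <#> K) = set_inv K <#> set_inv H"
  using assms by (force simp: SET_INV_def set_mult_def inv_mult_group)

text \<open>Fix one factorisation s = x z for each s in XZ and send (s, y) to (x y^-1, y z). The
  product of the two components returns s, hence x and z, and then the second component returns y;
  so the map is injective.\<close>

lemma ruzsa_triangle: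
  assumes "X \<subseteq> carrier G" "Y \<subseteq> carrier G" "Z \<subseteq> carrier G"
    and "finite X" "finite Y" "finite Z"
  shows "card (X <#> Z) * card Y \<le> card (X <#> set_inv Y) * card (Y <#> Z)"
proof -
  have "\<exists>q. fst q \<in> X \<and> snd q \<in> Z \<and> fst q \<otimes> snd q = s" if "s \<in> X <#> Z" for s
    using that by (auto simp: set_mult_def)
  then obtain q where q: "\<And>s. s \<in> X <#> Z \<Longrightarrow> fst (q s) \<in> X \<and> snd (q s) \<in> Z \<and> fst (q s) \<otimes> snd (q s) = s"
    by metis
  let ?f = "\<lambda>(s, y). (fst (q s) \<otimes> inv y, y \<otimes> snd (q s))"
  have prod: "fst (?f (s, y)) \<otimes> snd (?f (s, y)) = s" if "s \<in> X <#> Z" "y \<in> Y" for s y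
  proof -
    have c: "fst (q s) \<in> carrier G" "snd (q s) \<in> carrier G" "y \<in> carrier G"
      using q[OF that(1)] that assms by auto
    then show ?thesis
      using q[OF that(1)] by (simp add: m_assoc) (simp flip: m_assoc[of "inv y"])
  qed
  have "inj_on ?f ((X <#> Z) \<times> Y)"
  proof (rule inj_onI, clarify)
    fix s y s' y'
    assume s: "s \<in> X <#> Z" "y \<in> Y" "s' \<in> X <#> Z" "y' \<in> Y"
      and e: "fst (q s) \<otimes> inv y = fst (q s') \<otimes> inv y'" "y \<otimes> snd (q s) = y' \<otimes> snd (q s')"
    have "s = s'"
      using prod[OF s(1,2)] prod[OF s(3,4)] e by simp
    moreover have "y = y'"
      using e(2) s q[OF s(1)] assms \<open>s = s'\<close> by (auto simp: subset_iff)
    ultimately show "s = s' \<and> y = y'" ..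
  qed
  moreover have "?f ` ((X <#> Z) \<times> Y) \<subseteq> (X <#> set_inv Y) \<times> (Y <#> Z)"
  proof safe
    fix s y assume "s \<in> X <#> Z" "y \<in> Y"
    then have "fst (q s) \<in> X" "snd (q s) \<in> Z" "y \<in> Y"
      using q[of s] by blast+
    then show "fst (q s) \<otimes> inv y \<in> X <#> set_inv Y" "y \<otimes> snd (q s) \<in> Y <#> Z"
      by (auto intro: set_multI set_invI)
  qed
  ultimately have "card ((X <#> Z) \<times> Y) \<le> card ((X <#> set_inv Y) \<times> (Y <#> Z))"
    using assms by (intro card_inj_on_le) (auto simp: finite_set_mult finite_set_inv)
  then show ?thesis
    by (simp add: card_cartesian_product)
qed

text \<open>The form suited to iteration: with all sizes measured in units of \<open>card Y\<close>,
  one use of the triangle inequality multiplies the constants.\<close>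

lemma ruzsa_triangle_scaled:
  fixes c d :: real
  assumes "X \<subseteq> carrier G" "Y \<subseteq> carrier G" "Z \<subseteq> carrier G"
    and "finite X" "finite Y" "finite Z" "Y \<noteq> {}" "0 \<le> c" "0 \<le> d"
    and "real (card (X <#> set_inv Y)) \<le> c * real (card Y)"
    and "real (card (Y <#> Z)) \<le> d * real (card Y)"
  shows "real (card (X <#> Z)) \<le> (c * d) * real (card Y)"
proof -
  have "real (card (X <#> Z)) * real (card Y) \<le> real (card (X <#> set_inv Y)) * real (card (Y <#> Z))"
    using ruzsa_triangle[OF assms(1-6)] by (metis of_nat_le_iff of_nat_mult)
  also have "\<dots> \<le> (c * real (card Y)) * (d * real (card Y))"
    using assms by (intro mult_mono) auto
  finally have "real (card (X <#> Z)) * real (card Y) \<le> ((c * d) * real (card Y)) * real (card Y)"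
    by (simp add: mult_ac)
  moreover have "real (card Y) > 0"
    using assms by (simp add: card_gt_0_iff)
  ultimately show ?thesis
    by simp
qed

text \<open>The word is AA(A A^-1 A A^-1)A^-1, the set that will contain AAwA^-1 for the pivot
  element w. It is built up by repeated use of the triangle inequality through A or A^-1, starting
  from the bounds for two and three letters.\<close>

lemma small_tripling_word:
  fixes K :: real
  assumes A: "A \<subseteq> carrier G" "finite A" "A \<noteq> {}" and K: "K \<ge> 1"
    and tripling: "real (card (A <#> A <#> A)) \<le> K * real (card A)"
  shows "real (card (A <#> A <#> A <#> set_inv A <#> A <#> set_inv A <#> set_inv A))
    \<le> K ^ 8 * real (card A)"
proof -
  define B where "B = set_inv A"
  have B: "B \<subseteq> carrier G" "finite B" "card B = card A" "set_inv B = A"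
    using A unfolding B_def
    by (simp_all add: set_inv_closed finite_set_inv card_set_inv set_inv_set_inv)
  have "B \<noteq> {}"
    using A(3) by (simp add: B_def SET_INV_def)
  note closed = set_mult_closed A(1) B(1)
  note fin = finite_set_mult A(2) B(2)
  \<comment> \<open>Normal form for words: products nested to the right, inverses pushed down to the
    letters \<open>A\<close> and \<open>B\<close>, and \<open>card B\<close> replaced by
    \<open>card A\<close>. Inverting a word thus reverses it and exchanges the two letters.\<close>
  note simps = closed fin A(3) \<open>B \<noteq> {}\<close> B(3,4) B_def[symmetric] set_inv_set_mult set_mult_assoc
  note tri = ruzsa_triangle_scaled
  have K0: "0 \<le> K" using K by simp
  \<comment> \<open>Right multiplication by a fixed element of \<open>A\<close> embeds AA in
    AAA.\<close>
  obtain a where a: "a \<in> A" using A by blast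
  have "(\<lambda>x. x \<otimes> a) ` (A <#> A) \<subseteq> A <#> A <#> A"
    using a by (force simp: set_mult_def)
  moreover have "inj_on (\<lambda>x. x \<otimes> a) (A <#> A)"
    using a A set_mult_closed[OF A(1) A(1)] by (intro inj_onI) (auto simp: subset_iff)
  ultimately have "card (A <#> A) \<le> card (A <#> A <#> A)"
    using fin by (intro card_inj_on_le) auto
  then have AA: "real (card (A <#> A)) \<le> K * card A"
    using tripling by linarith
  have "card (set_inv (A <#> A)) = card (A <#> A)"
    by (rule card_set_inv) (simp add: closed)
  then have BB: "real (card (B <#> B)) \<le> K * card A"
    using AA by (simp add: simps)
  have AAA: "real (card (A <#> (A <#> A))) \<le> K * card A"
    using tripling by (simp add: simps)
  have BAA: "real (card (B <#> (A <#> A))) \<le> (K * K) * card A"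
    by (rule tri[where Y = A]) (use BB AAA K0 in \<open>simp_all add: simps\<close>)
  have "card (set_inv (B <#> (A <#> A))) = card (B <#> (A <#> A))"
    by (rule card_set_inv) (simp add: closed)
  then have BBA: "real (card (B <#> (B <#> A))) \<le> (K * K) * card A"
    using BAA by (simp add: simps)
  have "real (card ((A <#> A) <#> (B <#> A))) \<le> (K * (K * K)) * card B"
    by (rule tri[where Y = B]) (use AAA BBA K0 in \<open>simp_all add: simps\<close>)
  then have AABA: "real (card (A <#> (A <#> (B <#> A)))) \<le> (K * (K * K)) * card A"
    by (simp add: simps)
  have "real (card ((A <#> A) <#> (A <#> A))) \<le> (K * (K * K)) * card B"
    by (rule tri[where Y = B]) (use AAA BAA K0 in \<open>simp_all add: simps\<close>)
  then have AAAA: "real (card (A <#> (A <#> (A <#> A)))) \<le> (K * (K * K)) * card A"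
    by (simp add: simps)
  have "real (card ((A <#> (A <#> A)) <#> (B <#> A))) \<le> ((K * (K * K)) * (K * K)) * card B"
    by (rule tri[where Y = B]) (use AAAA BBA K0 in \<open>simp_all add: simps\<close>)
  then have AAABA: "real (card (A <#> (A <#> (A <#> (B <#> A))))) \<le> ((K * (K * K)) * (K * K)) * card A"
    by (simp add: simps)
  have "card (set_inv (A <#> (A <#> (B <#> A)))) = card (A <#> (A <#> (B <#> A)))"
    by (rule card_set_inv) (simp add: closed)
  then have BABB: "real (card (B <#> (A <#> (B <#> B)))) \<le> (K * (K * K)) * card A"
    using AABA by (simp add: simps)
  \<comment> \<open>Splitting the seven letters as AAAB and ABB puts AAABA, with exponent 5, and
    BABB, with exponent 3, on the right-hand side; hence the exponent 8.\<close>
  have "real (card ((A <#> (A <#> (A <#> B))) <#> (A <#> (B <#> B))))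
      \<le> (((K * (K * K)) * (K * K)) * (K * (K * K))) * card B"
    by (rule tri[where Y = B]) (use AAABA BABB K0 in \<open>simp_all add: simps\<close>)
  then show ?thesis
    by (simp add: simps eval_nat_numeral mult_ac)
qed

end

text \<open>Cauchy-Schwarz over the fibres of \<open>f\<close>: their sizes sum to
  \<open>card A\<close>, and their squares sum to the number of colliding pairs.\<close>

lemma card_image_collisions:
  assumes "finite A"
  shows "(card A)\<^sup>2 \<le> card (f ` A) * card {(a, b). a \<in> A \<and> b \<in> A \<and> f a = f b}"
proof -
  let ?F = "\<lambda>y. {a \<in> A. f a = y}"
  have "real (card A) = (\<Sum>y\<in>f ` A. real (card (?F y)))"
    using sum_fun_comp[of A "f ` A" f "\<lambda>_. 1::real"] assms by simp
  then have "(real (card A))\<^sup>2 \<le> (\<Sum>y\<in>f ` A. (real (card (?F y)))\<^sup>2) * real (card (f ` A))"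
    using sum_squared_le_sum_of_squares[of "\<lambda>y. real (card (?F y))" "f ` A"] assms
    by simp
  moreover have "card {(a, b). a \<in> A \<and> b \<in> A \<and> f a = f b} = (\<Sum>y\<in>f ` A. (card (?F y))\<^sup>2)"
  proof -
    have "{(a, b). a \<in> A \<and> b \<in> A \<and> f a = f b} = (\<Union>y\<in>f ` A. ?F y \<times> ?F y)"
      by auto
    then show ?thesis
      using assms by (simp only:, subst card_UN_disjoint)
        (auto simp: card_cartesian_product power2_eq_square)
  qed
  ultimately have "real ((card A)\<^sup>2) \<le> real (card (f ` A) * card {(a, b). a \<in> A \<and> b \<in> A \<and> f a = f b})"
    by (simp add: mult_ac)
  then show ?thesis
    by linarith
qed


section \<open>The affine group: slopes, fixed points, tori and cosets of the translations\<close>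

context field
begin

text \<open>The coefficient a of x -> ax + b, read off the map itself so that no representation has
  to be chosen. It is multiplicative on \<open>Aff R\<close>, with the translations as
  kernel.\<close>

abbreviation slope :: "('a \<Rightarrow> 'a) \<Rightarrow> 'a"
  where "slope f \<equiv> f \<one> \<ominus> f \<zero>"

lemma Aff_cases:
  assumes "f \<in> carrier (Aff R)"
  obtains a b where "f = affine_map R a b" "a \<in> carrier R - {\<zero>}" "b \<in> carrier R"
  using assms by (auto simp: Aff_def)

lemma affine_map_in_Aff:
  "a \<in> carrier R - {\<zero>} \<Longrightarrow> b \<in> carrier R \<Longrightarrow> affine_map R a b \<in> carrier (Aff R)"
  by (auto simp: Aff_def)

lemma affine_map_apply: "x \<in> carrier R \<Longrightarrow> affine_map R a b x = a \<otimes> x \<oplus> b"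
  by (simp add: affine_map_def)

lemma slope_affine_map:
  "a \<in> carrier R \<Longrightarrow> b \<in> carrier R \<Longrightarrow> slope (affine_map R a b) = a"
  by (simp add: affine_map_apply a_minus_def a_assoc r_neg)

lemma Aff_apply_closed:
  "f \<in> carrier (Aff R) \<Longrightarrow> x \<in> carrier R \<Longrightarrow> f x \<in> carrier R"
  by (erule Aff_cases) (simp add: affine_map_apply)

lemma slope_closed:
  assumes "f \<in> carrier (Aff R)"
  shows "slope f \<in> carrier R" "slope f \<noteq> \<zero>"
  using assms by (auto elim!: Aff_cases simp: slope_affine_map)

lemma Aff_mult_apply:
  assumes "f \<in> carrier (Aff R)" "g \<in> carrier (Aff R)" "x \<in> carrier R"
  shows "(f \<otimes>\<^bsub>Aff R\<^esub> g) x = f (g x)"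
proof -
  obtain a b c d where *: "f = affine_map R a b" "g = affine_map R c d"
    "a \<in> carrier R - {\<zero>}" "b \<in> carrier R" "c \<in> carrier R - {\<zero>}" "d \<in> carrier R"
    using assms by (elim Aff_cases)
  show ?thesis
    unfolding *(1,2) affine_map_mult[OF *(3-6)] using *(3-6) assms(3)
    by (simp add: affine_map_apply r_distr m_assoc a_assoc)
qed

lemma Aff_one_apply: "x \<in> carrier R \<Longrightarrow> \<one>\<^bsub>Aff R\<^esub> x = x"
  by (simp flip: affine_map_one add: affine_map_apply)

lemma Aff_inv_apply:
  assumes "f \<in> carrier (Aff R)" "x \<in> carrier R"
  shows "(inv\<^bsub>Aff R\<^esub> f) (f x) = x"
proof -
  interpret G: group "Aff R" by (rule group_Aff)
  have "(inv\<^bsub>Aff R\<^esub> f \<otimes>\<^bsub>Aff R\<^esub> f) x = (inv\<^bsub>Aff R\<^esub> f) (f x)"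
    using assms by (intro Aff_mult_apply) auto
  then show ?thesis
    using assms by (simp add: Aff_one_apply)
qed

lemma slope_diff:
  assumes "f \<in> carrier (Aff R)" "x \<in> carrier R" "y \<in> carrier R"
  shows "f x \<ominus> f y = slope f \<otimes> (x \<ominus> y)"
proof -
  obtain a b where f: "f = affine_map R a b" "a \<in> carrier R - {\<zero>}" "b \<in> carrier R"
    using assms by (elim Aff_cases)
  have "a \<otimes> x \<oplus> b \<ominus> (a \<otimes> y \<oplus> b) = a \<otimes> x \<oplus> (b \<oplus> \<ominus> b) \<oplus> \<ominus> (a \<otimes> y)"
    using f assms by (simp add: a_minus_def minus_add a_ac del: r_neg)
  also have "\<dots> = a \<otimes> (x \<ominus> y)"
    using f assms by (simp add: a_minus_def r_distr r_minus r_neg)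
  finally show ?thesis
    using f assms by (simp add: slope_affine_map) (simp add: affine_map_apply)
qed

lemma slope_mult:
  assumes "f \<in> carrier (Aff R)" "g \<in> carrier (Aff R)"
  shows "slope (f \<otimes>\<^bsub>Aff R\<^esub> g) = slope f \<otimes> slope g"
  using assms slope_diff[of f "g \<one>" "g \<zero>"] by (simp add: Aff_mult_apply Aff_apply_closed)

lemma slope_one: "slope \<one>\<^bsub>Aff R\<^esub> = \<one>"
  by (simp add: Aff_one_apply a_minus_def)

lemma slope_inv:
  assumes "f \<in> carrier (Aff R)"
  shows "slope f \<otimes> slope (inv\<^bsub>Aff R\<^esub> f) = \<one>"
proof -
  interpret G: group "Aff R" by (rule group_Aff)
  show ?thesis
    using assms slope_one slope_mult[of f "inv\<^bsub>Aff R\<^esub> f"] by simp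
qed

lemma slope_conj:
  assumes "f \<in> carrier (Aff R)" "g \<in> carrier (Aff R)"
  shows "slope (f \<otimes>\<^bsub>Aff R\<^esub> g \<otimes>\<^bsub>Aff R\<^esub> inv\<^bsub>Aff R\<^esub> f) = slope g"
proof -
  interpret G: group "Aff R" by (rule group_Aff)
  have s: "slope f \<in> carrier R" "slope g \<in> carrier R" "slope (inv\<^bsub>Aff R\<^esub> f) \<in> carrier R"
    using assms slope_closed by auto
  have "slope (f \<otimes>\<^bsub>Aff R\<^esub> g \<otimes>\<^bsub>Aff R\<^esub> inv\<^bsub>Aff R\<^esub> f)
      = slope f \<otimes> slope g \<otimes> slope (inv\<^bsub>Aff R\<^esub> f)"
    using assms by (simp only: slope_mult G.m_closed G.inv_closed)
  also have "\<dots> = slope g \<otimes> (slope f \<otimes> slope (inv\<^bsub>Aff R\<^esub> f))"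
    using s by (simp only: m_ac m_closed)
  finally show ?thesis
    unfolding slope_inv[OF assms(1)] using s by (simp only: r_one)
qed

lemma Aff_eqI:
  assumes "f \<in> carrier (Aff R)" "g \<in> carrier (Aff R)" "slope f = slope g"
    and "x \<in> carrier R" "f x = g x"
  shows "f = g"
proof -
  obtain a b c d where *: "f = affine_map R a b" "g = affine_map R c d"
    "a \<in> carrier R - {\<zero>}" "b \<in> carrier R" "c \<in> carrier R - {\<zero>}" "d \<in> carrier R"
    using assms by (elim Aff_cases)
  then have "a = c"
    using assms(3) by (simp add: slope_affine_map)
  moreover have "b = d"
    using assms(4,5) * \<open>a = c\<close> by (simp add: affine_map_apply)
  ultimately show ?thesis
    using * by simp
qed

text \<open>Two agreement points x, y give slope f (x - y) = slope g (x - y), and x - y could be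
  cancelled if it were nonzero.\<close>

lemma Aff_agree_unique:
  assumes "f \<in> carrier (Aff R)" "g \<in> carrier (Aff R)" "slope f \<noteq> slope g"
    and "x \<in> carrier R" "y \<in> carrier R" "f x = g x" "f y = g y"
  shows "x = y"
proof (rule ccontr)
  assume "x \<noteq> y"
  then have "x \<ominus> y \<noteq> \<zero>" "x \<ominus> y \<in> carrier R"
    using assms by auto
  moreover have "slope f \<otimes> (x \<ominus> y) = slope g \<otimes> (x \<ominus> y)"
    using slope_diff[of f x y] slope_diff[of g x y] assms by simp
  ultimately show False
    using assms slope_closed m_rcancel by metis
qed

lemma Aff_fixed_point_unique:
  assumes "f \<in> carrier (Aff R)" "slope f \<noteq> \<one>" "x \<in> carrier R" "y \<in> carrier R"
    and "f x = x" "f y = y"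
  shows "x = y"
proof -
  interpret G: group "Aff R" by (rule group_Aff)
  show ?thesis
    using assms Aff_agree_unique[of f "\<one>\<^bsub>Aff R\<^esub>" x y, unfolded slope_one]
    by (simp add: Aff_one_apply)
qed

lemma Aff_fixed_point_exists:
  assumes "f \<in> carrier (Aff R)" "slope f \<noteq> \<one>"
  obtains z where "z \<in> carrier R" "f z = z"
proof -
  obtain a b where f: "f = affine_map R a b" "a \<in> carrier R - {\<zero>}" "b \<in> carrier R"
    using assms by (elim Aff_cases)
  define d where "d = \<one> \<ominus> a"
  have "\<one> \<noteq> a"
    using f assms by (simp add: slope_affine_map)
  then have d: "d \<in> carrier R" "d \<noteq> \<zero>"
    using f by (auto simp: d_def)
  then have d': "inv d \<in> carrier R" "d \<otimes> inv d = \<one>"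
    using field_Units by auto
  define z where "z = inv d \<otimes> b"
  have z: "z \<in> carrier R" "d \<otimes> z = b"
    using d d' f by (simp_all add: z_def flip: m_assoc)
  have "a \<otimes> z \<oplus> b = (a \<oplus> d) \<otimes> z"
    using z d f by (simp add: l_distr)
  also have "a \<oplus> d = \<one>"
    using f by (simp add: d_def a_minus_def a_lcomm[of a] r_neg)
  finally have "f z = z"
    using f z by (simp add: affine_map_apply)
  then show ?thesis
    using that z by blast
qed

lemma translation_subgroup_eq:
  "translation_subgroup R = {f \<in> carrier (Aff R). slope f = \<one>}"
  by (auto simp: translation_subgroup_def slope_affine_map intro!: affine_map_in_Aff
      elim!: Aff_cases)

lemma dilation_subgroup_eq:
  "dilation_subgroup R = {f \<in> carrier (Aff R). f \<zero> = \<zero>}"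
  by (auto simp: dilation_subgroup_def affine_map_apply intro!: affine_map_in_Aff
      elim!: Aff_cases)

text \<open>The dilations are the stabilizer of 0, and conjugation by the translation taking 0 to
  \<open>z\<close> carries it to the stabilizer of \<open>z\<close>. A common fixed point of
  \<open>A\<close> therefore puts \<open>A\<close> in a torus.\<close>

lemma maximal_torus_point_stabilizer:
  assumes z: "z \<in> carrier R"
  shows "maximal_torus R {f \<in> carrier (Aff R). f z = z}" (is "maximal_torus R ?T")
proof -
  interpret G: group "Aff R" by (rule group_Aff)
  have "subgroup ?T (Aff R)"
  proof (rule G.subgroupI)
    show "inv\<^bsub>Aff R\<^esub> f \<in> ?T" if "f \<in> ?T" for f
      using that Aff_inv_apply[of f z] z by simp
  qed (use z in \<open>auto simp: Aff_mult_apply Aff_one_apply intro!: exI[of _ "\<one>\<^bsub>Aff R\<^esub>"]\<close>)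
  moreover
  define t where "t = affine_map R \<one> z"
  have t: "t \<in> carrier (Aff R)" "t \<zero> = z" "(inv\<^bsub>Aff R\<^esub> t) z = \<zero>"
    using z affine_map_in_Aff[of \<one> z] Aff_inv_apply[of t \<zero>]
    by (simp_all add: t_def affine_map_apply)
  have "?T = (\<lambda>h. t \<otimes>\<^bsub>Aff R\<^esub> h \<otimes>\<^bsub>Aff R\<^esub> inv\<^bsub>Aff R\<^esub> t) ` dilation_subgroup R"
  proof (intro equalityI subsetI)
    fix f assume "f \<in> ?T"
    then have f: "f \<in> carrier (Aff R)" "f z = z" by auto
    let ?h = "inv\<^bsub>Aff R\<^esub> t \<otimes>\<^bsub>Aff R\<^esub> (f \<otimes>\<^bsub>Aff R\<^esub> t)"
    have "?h \<zero> = \<zero>"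
      using f t z by (simp add: Aff_mult_apply)
    then have "?h \<in> dilation_subgroup R"
      using f t by (simp add: dilation_subgroup_eq)
    moreover have "f = t \<otimes>\<^bsub>Aff R\<^esub> ?h \<otimes>\<^bsub>Aff R\<^esub> inv\<^bsub>Aff R\<^esub> t"
      using f t by (simp add: G.m_assoc G.inv_solve_right' flip: G.m_assoc[of t])
    ultimately show "f \<in> (\<lambda>h. t \<otimes>\<^bsub>Aff R\<^esub> h \<otimes>\<^bsub>Aff R\<^esub> inv\<^bsub>Aff R\<^esub> t) ` dilation_subgroup R"
      by blast
  qed (use t z in \<open>auto simp: dilation_subgroup_eq Aff_mult_apply\<close>)
  ultimately show ?thesis
    using t unfolding maximal_torus_def by blast
qed

text \<open>Since U is the kernel of the slope, aU is the whole slope fibre through a. Cosets met by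
  \<open>A\<close> can thus be counted by slopes.\<close>

lemma card_left_cosets_translation_le:
  assumes "A \<subseteq> carrier (Aff R)" "finite A"
  shows "card (left_cosets_of (Aff R) A (translation_subgroup R)) \<le> card (slope ` A)"
proof -
  interpret G: group "Aff R" by (rule group_Aff)
  have "f <#\<^bsub>Aff R\<^esub> translation_subgroup R = {h \<in> carrier (Aff R). slope h = slope f}"
    if f: "f \<in> carrier (Aff R)" for f
  proof (intro equalityI subsetI)
    fix h assume "h \<in> f <#\<^bsub>Aff R\<^esub> translation_subgroup R"
    then show "h \<in> {h \<in> carrier (Aff R). slope h = slope f}"
      using f slope_closed[OF f] slope_mult[OF f]
      by (auto simp: l_coset_def translation_subgroup_eq)
  next
    fix h assume "h \<in> {h \<in> carrier (Aff R). slope h = slope f}"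
    then have h: "h \<in> carrier (Aff R)" "slope h = slope f" by auto
    let ?u = "inv\<^bsub>Aff R\<^esub> f \<otimes>\<^bsub>Aff R\<^esub> h"
    have "slope ?u = slope (inv\<^bsub>Aff R\<^esub> f) \<otimes> slope f"
      using slope_mult[of "inv\<^bsub>Aff R\<^esub> f" h] f h by simp
    also have "\<dots> = \<one>"
      using slope_inv[OF f] slope_closed f by (metis G.inv_closed m_comm)
    finally have "?u \<in> translation_subgroup R"
      using f h by (simp add: translation_subgroup_eq)
    moreover have "h = f \<otimes>\<^bsub>Aff R\<^esub> ?u"
      using f h by (simp flip: G.m_assoc)
    ultimately show "h \<in> f <#\<^bsub>Aff R\<^esub> translation_subgroup R"
      by (auto simp: l_coset_def)
  qed
  then have "left_cosets_of (Aff R) A (translation_subgroup R)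
      = (\<lambda>c. {h \<in> carrier (Aff R). slope h = c}) ` slope ` A"
    using assms by (auto simp: left_cosets_of_def image_image intro!: image_cong)
  then show ?thesis
    using assms by (simp add: card_image_le)
qed


section \<open>Growth from a pivot with a large orbit\<close>

text \<open>Choose \<open>s t\<close> in \<open>A\<close> of slope t, and \<open>r y\<close> in
  \<open>A\<close> taking \<open>x\<close> to y. The conjugate \<open>C y\<close> of
  \<open>g\<close> by \<open>r y\<close> has the slope of \<open>g\<close> and fixes y alone. The
  slope of the product of \<open>s t\<close> and \<open>C y\<close> determines t; cancelling
  \<open>s t\<close> leaves \<open>C y\<close>, whose unique fixed point is y.\<close>

lemma card_slope_mult_card_orbit_le:
  assumes A: "A \<subseteq> carrier (Aff R)" "finite A"
    and g: "g \<in> carrier (Aff R)" "slope g \<noteq> \<one>"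
    and x: "x \<in> carrier R" "g x = x"
  shows "card (slope ` A) * card ((\<lambda>f. f x) ` A)
    \<le> card (A <#>\<^bsub>Aff R\<^esub> A <#>\<^bsub>Aff R\<^esub> {g} <#>\<^bsub>Aff R\<^esub> set_inv\<^bsub>Aff R\<^esub> A)"
proof -
  interpret G: group "Aff R" by (rule group_Aff)
  define s where "s = inv_into A slope"
  define r where "r = inv_into A (\<lambda>f. f x)"
  have s: "s t \<in> A" "slope (s t) = t" if "t \<in> slope ` A" for t
    using inv_into_into[OF that] f_inv_into_f[OF that] by (simp_all add: s_def)
  have r: "r y \<in> A" "r y x = y" if "y \<in> (\<lambda>f. f x) ` A" for y
    using inv_into_into[OF that] f_inv_into_f[OF that] by (simp_all add: r_def)
  define C where "C y = r y \<otimes>\<^bsub>Aff R\<^esub> g \<otimes>\<^bsub>Aff R\<^esub> inv\<^bsub>Aff R\<^esub> (r y)" for y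
  have C: "C y \<in> carrier (Aff R)" "slope (C y) = slope g" "C y y = y" "y \<in> carrier R"
    if y: "y \<in> (\<lambda>f. f x) ` A" for y
  proof -
    have ry: "r y \<in> carrier (Aff R)"
      using r[OF y] A by auto
    show "C y \<in> carrier (Aff R)"
      using ry g by (simp add: C_def)
    show "slope (C y) = slope g"
      unfolding C_def using ry g by (intro slope_conj)
    show "y \<in> carrier R"
      using Aff_apply_closed[OF ry x(1)] r[OF y] by simp
    have "(inv\<^bsub>Aff R\<^esub> (r y)) y = x"
      using Aff_inv_apply[OF ry x(1)] r[OF y] by simp
    then show "C y y = y"
      using ry g x r[OF y] \<open>y \<in> carrier R\<close> by (simp add: C_def Aff_mult_apply)
  qed
  let ?F = "\<lambda>(t, y). s t \<otimes>\<^bsub>Aff R\<^esub> C y"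
  let ?D = "slope ` A \<times> (\<lambda>f. f x) ` A"
  have "inj_on ?F ?D"
  proof (rule inj_onI)
    fix q q'
    assume q: "q \<in> ?D" "q' \<in> ?D" "?F q = ?F q'"
    obtain t y t' y' where qq: "q = (t, y)" "q' = (t', y')"
      by (metis surj_pair)
    have t: "t \<in> slope ` A" "t' \<in> slope ` A"
      and y: "y \<in> (\<lambda>f. f x) ` A" "y' \<in> (\<lambda>f. f x) ` A"
      and e: "s t \<otimes>\<^bsub>Aff R\<^esub> C y = s t' \<otimes>\<^bsub>Aff R\<^esub> C y'"
      using q unfolding qq by simp_all
    have st: "s t \<in> carrier (Aff R)" "s t' \<in> carrier (Aff R)"
      using s t A by auto
    have "t \<otimes> slope g = t' \<otimes> slope g"
      using slope_mult[OF st(1) C(1)[OF y(1)]] slope_mult[OF st(2) C(1)[OF y(2)]]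
      unfolding s(2)[OF t(1)] s(2)[OF t(2)] C(2)[OF y(1)] C(2)[OF y(2)] e by (rule trans[OF sym])
    then have "t = t'"
      using slope_closed[OF g(1)] slope_closed(1)[OF st(1)] slope_closed(1)[OF st(2)]
      unfolding s(2)[OF t(1)] s(2)[OF t(2)] by (simp add: m_rcancel)
    then have "C y = C y'"
      using e st C(1)[OF y(1)] C(1)[OF y(2)] by simp
    then have "y = y'"
      using Aff_fixed_point_unique[of "C y" y y'] C[OF y(1)] C[OF y(2)] g(2) by metis
    then show "q = q'"
      using \<open>t = t'\<close> qq by simp
  qed
  moreover have "?F ` ?D \<subseteq> A <#>\<^bsub>Aff R\<^esub> A <#>\<^bsub>Aff R\<^esub> {g} <#>\<^bsub>Aff R\<^esub> set_inv\<^bsub>Aff R\<^esub> A"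
  proof safe
    fix f h assume "f \<in> A" "h \<in> A"
    define u v where "u = s (slope f)" and "v = r (h x)"
    have uv: "u \<in> A" "v \<in> A"
      using s r \<open>f \<in> A\<close> \<open>h \<in> A\<close> by (auto simp: u_def v_def)
    have "u \<otimes>\<^bsub>Aff R\<^esub> C (h x)
        = u \<otimes>\<^bsub>Aff R\<^esub> v \<otimes>\<^bsub>Aff R\<^esub> g \<otimes>\<^bsub>Aff R\<^esub> inv\<^bsub>Aff R\<^esub> v"
      using uv A g by (simp add: C_def v_def[symmetric] G.m_assoc subset_iff)
    then show "s (slope f) \<otimes>\<^bsub>Aff R\<^esub> C (h x)
        \<in> A <#>\<^bsub>Aff R\<^esub> A <#>\<^bsub>Aff R\<^esub> {g} <#>\<^bsub>Aff R\<^esub> set_inv\<^bsub>Aff R\<^esub> A"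
      using uv unfolding u_def[symmetric] by (simp add: G.set_multI G.set_invI)
  qed
  ultimately have "card ?D \<le> card (A <#>\<^bsub>Aff R\<^esub> A <#>\<^bsub>Aff R\<^esub> {g} <#>\<^bsub>Aff R\<^esub> set_inv\<^bsub>Aff R\<^esub> A)"
    using A by (intro card_inj_on_le) (auto intro!: G.finite_set_mult G.finite_set_inv)
  then show ?thesis
    by (simp add: card_cartesian_product)
qed

text \<open>A second-moment average: two distinct affine maps agree in at most one point, so over
  all \<open>x\<close> there are few collisions f x = h x, and by Cauchy-Schwarz few collisions mean
  a large orbit.\<close>

lemma exists_large_orbit:
  assumes fin: "finite (carrier R)" and A: "A \<subseteq> carrier (Aff R)" "finite A" "A \<noteq> {}"
  obtains x where "x \<in> carrier R"
    and "min (card A) (card (carrier R)) \<le> 2 * card ((\<lambda>f. f x) ` A)"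
proof -
  define P where "P = card (carrier R)"
  define N where "N = card A"
  define \<mu> where "\<mu> = min N P"
  define E where "E x = card {(f, h). f \<in> A \<and> h \<in> A \<and> f x = h x}" for x
  have pos: "0 < P" "0 < N"
    using fin A zero_closed by (auto simp: P_def N_def card_gt_0_iff)
  have "(\<Sum>x\<in>carrier R. E x) = (\<Sum>q\<in>A \<times> A. card {x \<in> carrier R. fst q x = snd q x})"
  proof -
    have "(\<Sum>x\<in>carrier R. card {q \<in> A \<times> A. fst q x = snd q x})
        = (\<Sum>q\<in>A \<times> A. card {x \<in> carrier R. fst q x = snd q x})"
      using fin A by (intro sum_multicount_gen) auto
    moreover have "{q \<in> A \<times> A. fst q x = snd q x} = {(f, h). f \<in> A \<and> h \<in> A \<and> f x = h x}" for x
      by auto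
    ultimately show ?thesis
      by (simp add: E_def)
  qed
  \<comment> \<open>A diagonal pair agrees at all \<open>P\<close> points, any other pair at no more
    than one. Allowing the extra 1 on the diagonal as well gives the closed form N P + N N.\<close>
  also have "\<dots> \<le> (\<Sum>q\<in>A \<times> A. (if fst q = snd q then P else 0) + 1)"
  proof (rule sum_mono, clarsimp simp: P_def[symmetric])
    fix f h assume fh: "f \<in> A" "h \<in> A" "f \<noteq> h"
    have "x = y" if "x \<in> carrier R" "y \<in> carrier R" "f x = h x" "f y = h y" for x y
      using Aff_agree_unique[of f h x y] Aff_eqI[of f h x] that fh A by blast
    then show "card {x \<in> carrier R. f x = h x} \<le> Suc 0"
      using fin by (subst card_le_Suc0_iff_eq) auto
  qed
  also have "\<dots> = N * P + N * N"
  proof -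
    have "(\<Sum>q\<in>A \<times> A. if fst q = snd q then P else 0) = (\<Sum>f\<in>A. \<Sum>h\<in>A. if f = h then P else 0)"
      by (simp add: sum.cartesian_product case_prod_beta)
    also have "\<dots> = N * P"
      using A by (simp add: N_def)
    finally show ?thesis
      unfolding sum.distrib by (simp add: N_def card_cartesian_product)
  qed
  finally have E: "(\<Sum>x\<in>carrier R. E x) \<le> N * P + N * N" .
  have "\<exists>x\<in>carrier R. \<mu> \<le> 2 * card ((\<lambda>f. f x) ` A)"
  proof (rule ccontr)
    assume "\<not> ?thesis"
    then have small: "2 * card ((\<lambda>f. f x) ` A) < \<mu>" if "x \<in> carrier R" for x
      using that by force
    have "2 * N\<^sup>2 < \<mu> * E x" if x: "x \<in> carrier R" for x
    proof -
      have c: "N\<^sup>2 \<le> card ((\<lambda>f. f x) ` A) * E x"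
        using card_image_collisions[OF A(2), of "\<lambda>f. f x"] by (simp add: N_def E_def)
      then have "0 < E x"
        using pos by (cases "E x = 0") auto
      have "2 * N\<^sup>2 \<le> (2 * card ((\<lambda>f. f x) ` A)) * E x"
        using c by simp
      also have "\<dots> < \<mu> * E x"
        using small[OF x] \<open>0 < E x\<close> by (rule mult_less_mono1)
      finally show ?thesis .
    qed
    then have "(\<Sum>x\<in>carrier R. 2 * N\<^sup>2) < (\<Sum>x\<in>carrier R. \<mu> * E x)"
      using fin by (intro sum_strict_mono) auto
    also have "\<dots> = \<mu> * (\<Sum>x\<in>carrier R. E x)"
      by (simp add: sum_distrib_left)
    also have "\<dots> \<le> \<mu> * (N * P + N * N)"
      using E by (rule mult_left_mono) simp
    also have "\<dots> = \<mu> * (N * P) + \<mu> * (N * N)"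
      by (rule distrib_left)
    \<comment> \<open>Bounding \<open>\<mu>\<close> by \<open>N\<close> in the first summand and by
      \<open>P\<close> in the second makes both equal to N N P, so the total is the left-hand sum 2
      N N P: a contradiction.\<close>
    also have "\<dots> \<le> N * (N * P) + P * (N * N)"
      by (intro add_mono mult_right_mono) (auto simp: \<mu>_def)
    finally show False
      by (simp add: P_def[symmetric] power2_eq_square)
  qed
  then show ?thesis
    using that by (auto simp: \<mu>_def N_def P_def)
qed

text \<open>The hypothesis \<open>translation\<close> isolates the property of prime fields that the
  argument uses: adding a fixed nonzero element repeatedly reaches every point. The factor 2 comes
  from the averaging case; leaving \<open>Q\<close> even gives an orbit of full size.\<close>

lemma exists_pivot:
  assumes translation: "\<forall>Q s. Q \<subseteq> carrier R \<longrightarrow> Q \<noteq> {} \<longrightarrow> s \<in> carrier R - {\<zero>} \<longrightarrow>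
      (\<forall>x\<in>Q. x \<oplus> s \<in> Q) \<longrightarrow> Q = carrier R"
    and fin: "finite (carrier R)"
    and A: "A \<subseteq> carrier (Aff R)" "finite A"
    and slopes: "f \<in> A" "g \<in> A" "slope f \<noteq> slope g"
    and no_fix: "\<forall>z\<in>carrier R. \<exists>h\<in>A. h z \<noteq> z"
  shows "\<exists>h\<in>A. \<exists>a\<in>A. \<exists>b\<in>A. \<exists>x\<in>carrier R. slope a \<noteq> slope b \<and> a x = b x \<and>
    min (card A) (card (carrier R)) \<le> 2 * card ((\<lambda>f. f (h x)) ` A)"
proof -
  interpret G: group "Aff R" by (rule group_Aff)
  define Q where "Q = {x \<in> carrier R. \<exists>a\<in>A. \<exists>b\<in>A. slope a \<noteq> slope b \<and> a x = b x}"
  show ?thesis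
  proof (cases "\<exists>h\<in>A. \<exists>x\<in>Q. h x \<notin> Q")
    case True
    then obtain h x where hx: "h \<in> A" "x \<in> Q" "h x \<notin> Q"
      by blast
    then have hx': "h x \<in> carrier R"
      using A by (auto simp: Q_def intro: Aff_apply_closed)
    \<comment> \<open>Outside \<open>Q\<close> agreement forces equal slopes, and two maps of equal
      slope that agree at a point coincide.\<close>
    have "inj_on (\<lambda>f. f (h x)) A"
    proof (rule inj_onI)
      fix a b assume ab: "a \<in> A" "b \<in> A" "a (h x) = b (h x)"
      then have "slope a = slope b"
        using hx hx' by (auto simp: Q_def)
      then show "a = b"
        using Aff_eqI ab A hx' by blast
    qed
    then have "card ((\<lambda>f. f (h x)) ` A) = card A"
      by (rule card_image)
    then have "min (card A) (card (carrier R)) \<le> 2 * card ((\<lambda>f. f (h x)) ` A)"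
      by simp
    then show ?thesis
      using hx(1,2) unfolding Q_def by blast
  next
    case False
    have Q: "Q \<subseteq> carrier R" "finite Q"
      using fin by (auto simp: Q_def)
    \<comment> \<open>By finiteness, stability makes each element of \<open>A\<close> permute
      \<open>Q\<close>, so \<open>Q\<close> is stable under inverses too, as the commutator below
      requires.\<close>
    have surj: "h ` Q = Q" if "h \<in> A" for h
    proof (rule endo_inj_surj[OF Q(2)])
      show "h ` Q \<subseteq> Q"
        using False that by blast
      show "inj_on h Q"
        using Aff_inv_apply[of h] that A Q(1) by (metis inj_onI subsetD)
    qed
    \<comment> \<open>The quotient g^-1 f has slope different from 1, so it has a fixed point, and
      there \<open>f\<close> and \<open>g\<close> agree.\<close>
    have "Q \<noteq> {}"
    proof -
      have fg: "f \<in> carrier (Aff R)" "g \<in> carrier (Aff R)"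
        using slopes A by auto
      have "slope (inv\<^bsub>Aff R\<^esub> g \<otimes>\<^bsub>Aff R\<^esub> f) \<noteq> \<one>"
      proof
        assume *: "slope (inv\<^bsub>Aff R\<^esub> g \<otimes>\<^bsub>Aff R\<^esub> f) = \<one>"
        have "slope (g \<otimes>\<^bsub>Aff R\<^esub> (inv\<^bsub>Aff R\<^esub> g \<otimes>\<^bsub>Aff R\<^esub> f)) = slope g"
          using slope_mult[of g "inv\<^bsub>Aff R\<^esub> g \<otimes>\<^bsub>Aff R\<^esub> f"] slope_closed(1)[OF fg(2)] fg
          unfolding * by simp
        then show False
          using slopes(3) fg by (simp flip: G.m_assoc)
      qed
      then obtain z where z: "z \<in> carrier R" "(inv\<^bsub>Aff R\<^esub> g \<otimes>\<^bsub>Aff R\<^esub> f) z = z"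
        using fg by (elim Aff_fixed_point_exists[rotated]) auto
      then have "(g \<otimes>\<^bsub>Aff R\<^esub> (inv\<^bsub>Aff R\<^esub> g \<otimes>\<^bsub>Aff R\<^esub> f)) z = g z"
        using fg by (simp only: Aff_mult_apply G.m_closed G.inv_closed)
      then have "f z = g z"
        using fg by (simp flip: G.m_assoc)
      then show ?thesis
        using z slopes by (auto simp: Q_def)
    qed
    \<comment> \<open>Take \<open>u\<close> of slope different from 1, with its unique fixed point
      z, and \<open>v\<close> moving z. If they commuted, \<open>u\<close> would also fix v
      z.\<close>
    obtain u v where uv: "u \<in> A" "v \<in> A" "u \<otimes>\<^bsub>Aff R\<^esub> v \<noteq> v \<otimes>\<^bsub>Aff R\<^esub> u"
    proof -
      obtain u where u: "u \<in> A" "slope u \<noteq> \<one>"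
        using slopes by metis
      then obtain z where z: "z \<in> carrier R" "u z = z"
        using A by (meson Aff_fixed_point_exists subsetD)
      obtain v where v: "v \<in> A" "v z \<noteq> z"
        using no_fix z by blast
      have c: "u \<in> carrier (Aff R)" "v \<in> carrier (Aff R)"
        using u v A by auto
      have "u (v z) \<noteq> v z"
        using Aff_fixed_point_unique[OF c(1) u(2), of "v z" z] v z c Aff_apply_closed by blast
      then have "u \<otimes>\<^bsub>Aff R\<^esub> v \<noteq> v \<otimes>\<^bsub>Aff R\<^esub> u"
        using Aff_mult_apply[of u v z] Aff_mult_apply[of v u z] c z by auto
      then show thesis
        using that u v by blast
    qed
    have c: "u \<in> carrier (Aff R)" "v \<in> carrier (Aff R)"
      using uv A by auto
    \<comment> \<open>The commutator of \<open>u\<close> and \<open>v\<close>. Slopes commute, so it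
      is a translation; it is nontrivial because \<open>u\<close> and \<open>v\<close> do not
      commute.\<close>
    let ?w = "(u \<otimes>\<^bsub>Aff R\<^esub> v) \<otimes>\<^bsub>Aff R\<^esub> inv\<^bsub>Aff R\<^esub> (v \<otimes>\<^bsub>Aff R\<^esub> u)"
    have w: "?w \<in> carrier (Aff R)"
      using c by simp
    have "slope ?w = \<one>"
    proof -
      have "slope ?w = slope (u \<otimes>\<^bsub>Aff R\<^esub> v) \<otimes> slope (inv\<^bsub>Aff R\<^esub> (v \<otimes>\<^bsub>Aff R\<^esub> u))"
        using c by (intro slope_mult) auto
      also have "slope (u \<otimes>\<^bsub>Aff R\<^esub> v) = slope (v \<otimes>\<^bsub>Aff R\<^esub> u)"
        using slope_mult[OF c] slope_mult[OF c(2,1)] slope_closed(1)[OF c(1)]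
          slope_closed(1)[OF c(2)] m_comm by metis
      finally show ?thesis
        using slope_inv[of "v \<otimes>\<^bsub>Aff R\<^esub> u"] c by simp
    qed
    then obtain s where s: "s \<in> carrier R" "?w = affine_map R \<one> s"
      using w by (elim Aff_cases) (auto simp: slope_affine_map)
    have "?w \<noteq> \<one>\<^bsub>Aff R\<^esub>"
    proof
      assume "?w = \<one>\<^bsub>Aff R\<^esub>"
      then have "u \<otimes>\<^bsub>Aff R\<^esub> v = v \<otimes>\<^bsub>Aff R\<^esub> u"
        using c by (metis G.inv_solve_right' G.l_one G.m_closed G.one_closed)
      then show False
        using uv by blast
    qed
    then have "s \<noteq> \<zero>"
      using s affine_map_one by auto
    have "x \<oplus> s \<in> Q" if x: "x \<in> Q" for x
    proof -
      \<comment> \<open>Pull \<open>x\<close> back through v u inside \<open>Q\<close>, then push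
        forward by u v: the result is the translate of \<open>x\<close>.\<close>
      obtain y where y: "y \<in> Q" "x = v (u y)"
        using x surj[OF uv(1)] surj[OF uv(2)] by (metis imageE)
      have cy: "y \<in> carrier R" "v (u y) = (v \<otimes>\<^bsub>Aff R\<^esub> u) y"
        using y Q c by (auto simp: Aff_mult_apply)
      have "(inv\<^bsub>Aff R\<^esub> (v \<otimes>\<^bsub>Aff R\<^esub> u)) x = y"
        using c cy y by (simp only: Aff_inv_apply G.m_closed)
      then have "?w x = u (v y)"
        using c cy x Q by (simp add: Aff_mult_apply subset_iff)
      moreover have "u (v y) \<in> Q"
        using y surj uv by blast
      moreover have "?w x = x \<oplus> s"
        using s x Q by (simp add: affine_map_apply a_comm subset_iff)
      ultimately show ?thesis
        by simp
    qed
    then have "Q = carrier R"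
      using translation[rule_format, OF Q(1) \<open>Q \<noteq> {}\<close>, of s] s \<open>s \<noteq> \<zero>\<close> by simp
    obtain y where y: "y \<in> carrier R"
      "min (card A) (card (carrier R)) \<le> 2 * card ((\<lambda>f. f y) ` A)"
      using exists_large_orbit[OF fin A] slopes by blast
    \<comment> \<open>The averaging point has to be of the form h x with x in \<open>Q\<close>;
      since \<open>f\<close> permutes \<open>Q\<close>, which is now the whole field,
      \<open>f\<close> can serve as h.\<close>
    obtain x where "x \<in> Q" "y = f x"
      using y(1) surj[OF slopes(1)] \<open>Q = carrier R\<close> by blast
    then show ?thesis
      using y(2) slopes(1) unfolding Q_def by blast
  qed
qed

lemma affine_growth:
  fixes K :: real
  assumes translation: "\<forall>Q s. Q \<subseteq> carrier R \<longrightarrow> Q \<noteq> {} \<longrightarrow> s \<in> carrier R - {\<zero>} \<longrightarrow>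
      (\<forall>x\<in>Q. x \<oplus> s \<in> Q) \<longrightarrow> Q = carrier R"
    and fin: "finite (carrier R)"
    and A: "A \<subseteq> carrier (Aff R)" "finite A"
    and slopes: "f \<in> A" "g \<in> A" "slope f \<noteq> slope g"
    and no_fix: "\<forall>z\<in>carrier R. \<exists>h\<in>A. h z \<noteq> z"
    and K: "K \<ge> 1"
    and tripling: "real (card (A <#>\<^bsub>Aff R\<^esub> A <#>\<^bsub>Aff R\<^esub> A)) \<le> K * real (card A)"
  shows "real (card (slope ` A)) * min (real (card A)) (real (card (carrier R)))
    \<le> 2 * K ^ 8 * real (card A)"
proof -
  interpret G: group "Aff R" by (rule group_Aff)
  obtain h a b x where p: "h \<in> A" "a \<in> A" "b \<in> A" "x \<in> carrier R"
    "slope a \<noteq> slope b" "a x = b x"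
    "min (card A) (card (carrier R)) \<le> 2 * card ((\<lambda>f. f (h x)) ` A)"
    using exists_pivot[OF translation fin A slopes no_fix] by (elim bexE conjE)
  have c: "h \<in> carrier (Aff R)" "a \<in> carrier (Aff R)" "b \<in> carrier (Aff R)"
    using p A by auto
  have "A \<noteq> {}"
    using p(1) by blast
  define u where "u = inv\<^bsub>Aff R\<^esub> a \<otimes>\<^bsub>Aff R\<^esub> b"
  \<comment> \<open>Since \<open>a\<close> and \<open>b\<close> agree at \<open>x\<close>,
    \<open>u\<close> fixes \<open>x\<close> and its conjugate \<open>w\<close> fixes h x;
    conjugation preserves the slope.\<close>
  define w where "w = h \<otimes>\<^bsub>Aff R\<^esub> u \<otimes>\<^bsub>Aff R\<^esub> inv\<^bsub>Aff R\<^esub> h"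
  have u: "u \<in> carrier (Aff R)"
    using c by (simp add: u_def)
  have w: "w \<in> carrier (Aff R)"
    using c u by (simp add: w_def)
  have "slope u \<noteq> \<one>"
  proof
    assume *: "slope u = \<one>"
    have "slope (a \<otimes>\<^bsub>Aff R\<^esub> u) = slope a"
      using slope_mult[OF c(2) u] slope_closed(1)[OF c(2)] unfolding * by simp
    then show False
      using p(5) c by (simp add: u_def flip: G.m_assoc)
  qed
  then have slope_w: "slope w \<noteq> \<one>"
    using slope_conj[OF c(1) u] by (simp add: w_def)
  have "(inv\<^bsub>Aff R\<^esub> a) (b x) = x"
    using p(4,6) Aff_inv_apply[OF c(2)] by metis
  then have "w (h x) = h x"
    using c u p(4) by (simp add: w_def u_def Aff_mult_apply Aff_apply_closed Aff_inv_apply)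
  then have "card (slope ` A) * card ((\<lambda>f. f (h x)) ` A)
      \<le> card (A <#>\<^bsub>Aff R\<^esub> A <#>\<^bsub>Aff R\<^esub> {w} <#>\<^bsub>Aff R\<^esub> set_inv\<^bsub>Aff R\<^esub> A)"
    using card_slope_mult_card_orbit_le[OF A w slope_w, of "h x"] Aff_apply_closed c(1) p(4) by blast
  also have "\<dots> \<le> card (A <#>\<^bsub>Aff R\<^esub> A <#>\<^bsub>Aff R\<^esub> A <#>\<^bsub>Aff R\<^esub> set_inv\<^bsub>Aff R\<^esub> A
      <#>\<^bsub>Aff R\<^esub> A <#>\<^bsub>Aff R\<^esub> set_inv\<^bsub>Aff R\<^esub> A <#>\<^bsub>Aff R\<^esub> set_inv\<^bsub>Aff R\<^esub> A)"
  proof (rule card_mono)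
    \<comment> \<open>As \<open>w\<close> is a product of four letters, AAwA^-1 lies in the
      seven-letter word controlled by \<open>small_tripling_word\<close>.\<close>
    have "w \<in> A <#>\<^bsub>Aff R\<^esub> set_inv\<^bsub>Aff R\<^esub> A <#>\<^bsub>Aff R\<^esub> A <#>\<^bsub>Aff R\<^esub> set_inv\<^bsub>Aff R\<^esub> A"
      using p(1-3) c by (simp add: w_def u_def G.set_multI G.set_invI flip: G.m_assoc)
    then have "A <#>\<^bsub>Aff R\<^esub> A <#>\<^bsub>Aff R\<^esub> {w} <#>\<^bsub>Aff R\<^esub> set_inv\<^bsub>Aff R\<^esub> A
        \<subseteq> A <#>\<^bsub>Aff R\<^esub> A <#>\<^bsub>Aff R\<^esub> (A <#>\<^bsub>Aff R\<^esub> set_inv\<^bsub>Aff R\<^esub> A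
          <#>\<^bsub>Aff R\<^esub> A <#>\<^bsub>Aff R\<^esub> set_inv\<^bsub>Aff R\<^esub> A) <#>\<^bsub>Aff R\<^esub> set_inv\<^bsub>Aff R\<^esub> A"
      by (intro mono_set_mult) auto
    then show "A <#>\<^bsub>Aff R\<^esub> A <#>\<^bsub>Aff R\<^esub> {w} <#>\<^bsub>Aff R\<^esub> set_inv\<^bsub>Aff R\<^esub> A
        \<subseteq> A <#>\<^bsub>Aff R\<^esub> A <#>\<^bsub>Aff R\<^esub> A <#>\<^bsub>Aff R\<^esub> set_inv\<^bsub>Aff R\<^esub> A
          <#>\<^bsub>Aff R\<^esub> A <#>\<^bsub>Aff R\<^esub> set_inv\<^bsub>Aff R\<^esub> A <#>\<^bsub>Aff R\<^esub> set_inv\<^bsub>Aff R\<^esub> A"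
      using A by (simp add: G.set_mult_assoc G.set_mult_closed G.set_inv_closed)
  qed (use A in \<open>auto intro!: G.finite_set_mult G.finite_set_inv\<close>)
  finally have "real (card (slope ` A) * card ((\<lambda>f. f (h x)) ` A)) \<le> K ^ 8 * real (card A)"
    by (rule order_trans[OF of_nat_mono G.small_tripling_word[OF A \<open>A \<noteq> {}\<close> K tripling]])
  moreover have "real (card (slope ` A)) * min (real (card A)) (real (card (carrier R)))
      \<le> real (card (slope ` A)) * (2 * real (card ((\<lambda>f. f (h x)) ` A)))"
    using p(7) by (intro mult_left_mono) linarith+
  ultimately show ?thesis
    by simp
qed

end

section \<open>The prime field and the three alternatives\<close>

text \<open>A nonzero \<open>s\<close> is invertible modulo p, so from any x in \<open>Q\<close> the
  point y is reached after s^-1 (y - x) steps of length \<open>s\<close>, this number being taken as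
  a residue.\<close>

lemma (in residues_prime) translation_invariant_eq_carrier:
  assumes "Q \<subseteq> carrier R" "Q \<noteq> {}" "s \<in> carrier R - {\<zero>}"
    and closed: "\<And>x. x \<in> Q \<Longrightarrow> x \<oplus> s \<in> Q"
  shows "Q = carrier R"
proof (intro equalityI assms(1) subsetI)
  fix y assume y: "y \<in> carrier R"
  obtain x where x: "x \<in> Q"
    using assms(2) by blast
  have iterate: "(x + int k * s) mod int p \<in> Q" for k
  proof (induction k)
    case 0
    then show ?case
      using x assms(1) by (auto simp: res_carrier_eq subset_iff)
  next
    case (Suc k)
    have "(x + int k * s) mod int p \<oplus> s = (x + int (Suc k) * s) mod int p"
      by (simp add: res_add_eq mod_simps algebra_simps)
    then show ?case
      using closed[OF Suc] by simp
  qed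
  have "coprime s (int p)"
    using assms(3) by (auto simp: p_coprime_right_int res_carrier_eq res_zero_eq zdvd_not_zless)
  then obtain t where t: "[s * t = 1] (mod int p)"
    using cong_solve_coprime_int by blast
  define k where "k = nat ((t * (y - x)) mod int p)"
  have "int k = (t * (y - x)) mod int p"
    using m_gt_one by (simp add: k_def)
  then have "[int k * s = t * (y - x) * s] (mod int p)"
    by (simp add: cong_def mod_simps)
  also have "t * (y - x) * s = s * t * (y - x)"
    by (simp add: mult_ac)
  also have "[s * t * (y - x) = 1 * (y - x)] (mod int p)"
    using t by (rule cong_scalar_right)
  finally have "[x + int k * s = x + (y - x)] (mod int p)"
    by (intro cong_add cong_refl) simp
  then have "(x + int k * s) mod int p = y"
    using y by (simp add: cong_def res_carrier_eq)
  then show "y \<in> Q"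
    using iterate[of k] by simp
qed

text \<open>A common fixed point gives a torus containing all of \<open>A\<close>, and a single
  slope gives n at most 1. Otherwise \<open>affine_growth\<close> applies, and the minimum of
  \<open>card A\<close> and p decides between the last two alternatives.\<close>

lemma (in residues_prime) affine_growth_trichotomy:
  fixes K :: real and A :: "(int \<Rightarrow> int) set"
  defines "n \<equiv> card (left_cosets_of (Aff R) A (translation_subgroup R))"
  assumes K: "K \<ge> 1" and A: "finite A" "A \<subseteq> carrier (Aff R)"
    and tripling: "real (card (A <#>\<^bsub>Aff R\<^esub> A <#>\<^bsub>Aff R\<^esub> A)) \<le> K * real (card A)"
  shows "(\<exists>T. maximal_torus R T \<and> real (card (A \<inter> T)) \<ge> real (card A) / 3)
    \<or> K ^ 10 * real (card A) \<ge> 1 / 2 * (sqrt (real n) * real (card A))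
    \<or> K ^ 10 * real (card A) \<ge> 1 / 2 * (real n * real p)"
proof -
  have n: "n \<le> card (slope ` A)"
    unfolding n_def using A by (intro card_left_cosets_translation_le)
  have K8: "1 \<le> K ^ 8" "K ^ 8 \<le> K ^ 10"
    using K by (auto intro: power_increasing)
  \<comment> \<open>For a natural number the square root is at most the number itself, so a bound
    linear in \<open>n\<close> yields the square root alternative.\<close>
  have large: "1 / 2 * (sqrt (real n) * real (card A)) \<le> K ^ 10 * real (card A)"
    if "real n \<le> 2 * K ^ 10"
  proof (intro mult_right_mono[of "1 / 2 * sqrt (real n)", simplified mult.assoc])
    have "sqrt (real n) \<le> real n"
      by (cases "n = 0") (auto intro!: real_le_lsqrt simp: power2_eq_square)
    then show "1 / 2 * sqrt (real n) \<le> K ^ 10"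
      using that by simp
  qed simp
  show ?thesis
  \<comment> \<open>The empty set falls under the first case, so \<open>A\<close> is nonempty
    afterwards.\<close>
  proof (cases "\<exists>z\<in>carrier R. \<forall>h\<in>A. h z = z")
    case True
    then obtain z where z: "z \<in> carrier R" "\<forall>h\<in>A. h z = z" ..
    then have "A \<inter> {f \<in> carrier (Aff R). f z = z} = A"
      using A by auto
    then show ?thesis
      using maximal_torus_point_stabilizer[OF z(1)] by (intro disjI1 exI conjI) auto
  next
    case no_torus: False
    show ?thesis
    proof (cases "\<forall>f\<in>A. \<forall>g\<in>A. slope f = slope g")
      case True
      then have "\<forall>c\<in>slope ` A. \<forall>d\<in>slope ` A. c = d"
        by blast
      then have "card (slope ` A) \<le> Suc 0"
        by (rule iffD2[OF card_le_Suc0_iff_eq[OF finite_imageI[OF A(1)]]])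
      then have "real n \<le> 1"
        using n by simp
      then have "real n \<le> 2 * K ^ 10"
        using K8 by linarith
      then show ?thesis
        using large by blast
    next
      case False
      then obtain f g where fg: "f \<in> A" "g \<in> A" "slope f \<noteq> slope g"
        by metis
      have no_fix: "\<forall>z\<in>carrier R. \<exists>h\<in>A. h z \<noteq> z"
        using no_torus by blast
      have translation: "\<forall>Q s. Q \<subseteq> carrier R \<longrightarrow> Q \<noteq> {} \<longrightarrow> s \<in> carrier R - {\<zero>} \<longrightarrow>
          (\<forall>x\<in>Q. x \<oplus> s \<in> Q) \<longrightarrow> Q = carrier R"
        by (intro allI impI translation_invariant_eq_carrier) auto
      have "card (carrier R) = p"
        by (simp add: res_carrier_eq)
      then have "real (card (slope ` A)) * min (real (card A)) (real p) \<le> 2 * K ^ 8 * real (card A)"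
        using affine_growth[OF translation finite A(2,1) fg no_fix K tripling] by simp
      moreover have "real n * min (real (card A)) (real p)
          \<le> real (card (slope ` A)) * min (real (card A)) (real p)"
        using n by (intro mult_right_mono) auto
      moreover have "2 * K ^ 8 * real (card A) \<le> 2 * K ^ 10 * real (card A)"
        using K8 by (intro mult_right_mono) auto
      ultimately have *: "real n * min (real (card A)) (real p) \<le> 2 * K ^ 10 * real (card A)"
        by linarith
      show ?thesis
      proof (cases "card A \<le> p")
        case True
        have "0 < real (card A)"
          using fg(1) A(1) by (auto simp: card_gt_0_iff)
        then have "real n \<le> 2 * K ^ 10"
          using * True by (simp add: min_def)
        then show ?thesis
          using large by blast
      next
        case False
        then show ?thesis
          using * by (simp add: min_def)
      qed
    qed
  qed
qed

theorem theoremB2: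
  shows "\<exists>c::real. c > 0 \<and>
    (\<forall>(p::nat) (K::real) (A::(int \<Rightarrow> int) set).
      let R = residue_ring (int p); G = Aff R; U = translation_subgroup R in
      prime p \<longrightarrow> K \<ge> 1 \<longrightarrow> finite A \<longrightarrow> A \<subseteq> carrier G \<longrightarrow>
      real (card (A <#>\<^bsub>G\<^esub> A <#>\<^bsub>G\<^esub> A)) \<le> K * real (card A) \<longrightarrow>
        (\<exists>T. maximal_torus R T \<and> real (card (A \<inter> T)) \<ge> real (card A) / 3)
      \<or> K ^ 10 * real (card A) \<ge> c * (sqrt (real (card (left_cosets_of G A U))) * real (card A))
      \<or> K ^ 10 * real (card A) \<ge> c * (real (card (left_cosets_of G A U)) * real p))"
\<comment> \<open>The constant 1/2 undoes the factor 2 lost in choosing a large orbit; it is the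
  same for all p, K and A.\<close>
proof (unfold Let_def, intro exI[of _ "1 / 2"] conjI allI impI)
  fix p :: nat and K :: real and A :: "(int \<Rightarrow> int) set"
  assume "prime p"
  then interpret residues_prime p "residue_ring (int p)"
    by unfold_locales
  show "(\<exists>T. maximal_torus (residue_ring (int p)) T \<and> real (card (A \<inter> T)) \<ge> real (card A) / 3)
      \<or> K ^ 10 * real (card A) \<ge> 1 / 2 * (sqrt (real (card (left_cosets_of
          (Aff (residue_ring (int p))) A (translation_subgroup (residue_ring (int p)))))) * real (card A))
      \<or> K ^ 10 * real (card A) \<ge> 1 / 2 * (real (card (left_cosets_of
          (Aff (residue_ring (int p))) A (translation_subgroup (residue_ring (int p))))) * real p)"
    if "K \<ge> 1" "finite A" "A \<subseteq> carrier (Aff (residue_ring (int p)))"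
      "real (card (A <#>\<^bsub>Aff (residue_ring (int p))\<^esub> A <#>\<^bsub>Aff (residue_ring (int p))\<^esub> A))
        \<le> K * real (card A)"
    using affine_growth_trichotomy[OF that] .
qed simp

end
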